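(* Let $m\in\mathbb{N}$, let $f(z)=\sum_{n=0}^{\infty}a_nz^n\in\mathcal{B}$, $a:=|a_0|$, and let $\omega\in\mathcal{B}_m$. Then $$A_f(z):=|f(\omega(z))|+B_1(f,r)+\frac{1+ar}{(1+a)(1-r)}\|f_0\|_r^2\le 1$$ for all $z$ with $|z|=r\in[0,\alpha_m]$, where $\alpha_m$ is the unique root in $(0,1)$ of the equation $$(1-r)(1-r^m)-2r(1+r^m)=0.$$ The constant $\alpha_m$ cannot be improved. Moreover, $$B_f(z):=|f(\omega(z))|^2+B_1(f,r)+\frac{1+ar}{(1+a)(1-r)}\|f_0\|_r^2\le 1$$ for all $z$ with $|z|=r\in[0,\beta_m]$, where $\beta_m$ is the unique root in $(0,1)$ of the equation $$1-2r-r^m=0.$$ The constant $\beta_m$ cannot be improved.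
   Context: $\mathbb{D}=\{z\in\mathbb{C}:|z|<1\}$ and $\mathbb{N}=\{1,2,\dots\}$. $\mathcal{B}$ is the class of analytic functions $f$ on $\mathbb{D}$ with $\sup_{z\in\mathbb{D}}|f(z)|\le 1$. For $m\in\mathbb{N}$, $\mathcal{B}_m$ is the set of $\omega\in\mathcal{B}$ with $\omega(0)=\omega'(0)=\cdots=\omega^{(m-1)}(0)=0$ and $\omega^{(m)}(0)\ne 0$. For $f(z)=\sum_{n\ge 0}a_nz^n\in\mathcal{B}$ put $f_0(z)=f(z)-f(0)$, $B_k(f,r)=\sum_{n=k}^{\infty}|a_n|r^n$ for $k\ge 0$, and $\|f_0\|_r^2=\sum_{n=1}^{\infty}|a_n|^2r^{2n}$. Throughout $r=|z|<1$. Saying that a constant $\rho$ (for given $m$) cannot be improved means that there is no $\rho'\in(\rho,1)$ such that the corresponding inequality holds for all $f\in\mathcal{B}$, all $\omega\in\mathcal{B}_m$ and all $z$ with $|z|\le\rho'$. *)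

theory Defs
  imports "HOL-Complex_Analysis.Complex_Analysis"
begin

definition schur_class :: "(complex \<Rightarrow> complex) set" where
  "schur_class = {f. f analytic_on ball 0 1 \<and> (\<forall>z\<in>ball 0 1. norm (f z) \<le> 1)}"

definition schur_class_ord :: "nat \<Rightarrow> (complex \<Rightarrow> complex) set" where
  "schur_class_ord m =
     {\<omega> \<in> schur_class. (\<forall>k<m. (deriv ^^ k) \<omega> 0 = 0) \<and> (deriv ^^ m) \<omega> 0 \<noteq> 0}"

abbreviation taylor_coeff :: "(complex \<Rightarrow> complex) \<Rightarrow> nat \<Rightarrow> complex" where
  "taylor_coeff f n \<equiv> fps_nth (fps_expansion f 0) n"

(* The infinite sums below start at n = k and n = 1; they are written with shifted index. *)

definition bohr_sum :: "nat \<Rightarrow> (complex \<Rightarrow> complex) \<Rightarrow> real \<Rightarrow> real" where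
  "bohr_sum k f r = (\<Sum>n. norm (taylor_coeff f (n + k)) * r ^ (n + k))"

(* The square of the r-norm of f - f(0). *)
definition f0_norm_sq :: "(complex \<Rightarrow> complex) \<Rightarrow> real \<Rightarrow> real" where
  "f0_norm_sq f r = (\<Sum>n. (norm (taylor_coeff f (n + 1)))\<^sup>2 * r ^ (2 * (n + 1)))"

definition bohr_tail :: "(complex \<Rightarrow> complex) \<Rightarrow> real \<Rightarrow> real" where
  "bohr_tail f r =
     (let a = norm (taylor_coeff f 0)
      in bohr_sum 1 f r + (1 + a * r) / ((1 + a) * (1 - r)) * f0_norm_sq f r)"

definition A_fun :: "(complex \<Rightarrow> complex) \<Rightarrow> (complex \<Rightarrow> complex) \<Rightarrow> complex \<Rightarrow> real" where
  "A_fun f \<omega> z = norm (f (\<omega> z)) + bohr_tail f (norm z)"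

definition B_fun :: "(complex \<Rightarrow> complex) \<Rightarrow> (complex \<Rightarrow> complex) \<Rightarrow> complex \<Rightarrow> real" where
  "B_fun f \<omega> z = (norm (f (\<omega> z)))\<^sup>2 + bohr_tail f (norm z)"

definition is_alpha :: "nat \<Rightarrow> real \<Rightarrow> bool" where
  "is_alpha m r \<longleftrightarrow> r \<in> {0<..<1} \<and> (1 - r) * (1 - r ^ m) - 2 * r * (1 + r ^ m) = 0"

definition is_beta :: "nat \<Rightarrow> real \<Rightarrow> bool" where
  "is_beta m r \<longleftrightarrow> r \<in> {0<..<1} \<and> 1 - 2 * r - r ^ m = 0"

end

theory Submission
  imports Defs
begin

text \<open>
  Write \<open>a\<close> for the modulus of \<open>f 0\<close>, let \<open>a\<^sub>0, a\<^sub>1, \<dots>\<close> be the Taylor coefficients of \<open>f\<close>, and put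
  \<open>r = |z|\<close> and \<open>R = r ^ m\<close>. Two estimates carry the proof.

  The first (\<open>bohr_tail_le\<close>) bounds all of the sum except the term containing \<open>\<omega>\<close> by
  \<open>(1 - a\<^sup>2) r / (1 - r)\<close>. It comes from Carlson's coefficient inequalities
  (\<open>Carlson_odd\<close>, \<open>Carlson_even\<close>)
  \<open>|a\<^sub>2\<^sub>n\<^sub>+\<^sub>1| \<le> 1 - (|a\<^sub>0|\<^sup>2 + \<dots> + |a\<^sub>n|\<^sup>2)\<close> and
  \<open>|a\<^sub>2\<^sub>n| \<le> 1 - (|a\<^sub>0|\<^sup>2 + \<dots> + |a\<^sub>n\<^sub>-\<^sub>1|\<^sup>2) - |a\<^sub>n|\<^sup>2 / (1 + a)\<close>: multiplying them by powers of \<open>r\<close>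
  and adding, the square \<open>|a\<^sub>k|\<^sup>2\<close> is subtracted with total weight
  \<open>r ^ (2k) (1 / (1 + a) + r / (1 - r))\<close>, and the bracket is exactly the factor
  \<open>(1 + a r) / ((1 + a) (1 - r))\<close>. Carlson's inequalities in turn follow from the bound
  \<open>|c\<^sub>N| \<le> \<Sum> |p\<^sub>k|\<^sup>2\<close> for the \<open>N\<close>-th Taylor coefficient \<open>c\<^sub>N\<close> of \<open>f P\<^sup>2\<close>, where \<open>P = \<Sum> p\<^sub>k z ^ k\<close>
  is any polynomial (\<open>norm_coeff_mult_square_le\<close>), by choosing \<open>P\<close> with coefficients built from
  conjugates of those of \<open>f\<close>.

  The second estimate is \<open>|f (\<omega> z)| \<le> (a + R) / (1 + a R)\<close> (\<open>norm_comp_le\<close>), which combines the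
  Schwarz lemma of order \<open>m\<close> for \<open>\<omega>\<close> with the Schwarz-Pick lemma for \<open>f\<close>.

  The sum of the two bounds is at most \<open>1\<close> if and only if \<open>a = 1\<close> or
  \<open>(1 + a) r (1 + a R) \<le> (1 - R) (1 - r)\<close>; for the squared first term the second condition becomes
  \<open>r (1 + a R)\<^sup>2 \<le> (1 - R\<^sup>2) (1 - r)\<close>. The case \<open>a = 1\<close> of these inequalities is the most
  restrictive one, and there they say that \<open>r\<close> does not exceed the root of the respective equation.
  Both estimates are equalities for \<open>f z = (z + a) / (1 + a z)\<close>, \<open>\<omega> z = z ^ m\<close> and \<open>z = r\<close>,
  so letting \<open>a\<close> tend to \<open>1\<close> shows that the constants are optimal.
\<close>

section \<open>Taylor coefficients of a bounded function times a squared polynomial\<close>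

lemma has_integral_cis_int:
  "((\<lambda>t. cis (of_int n * t)) has_integral (if n = 0 then of_real (2 * pi) else 0)) {0..2 * pi}"
proof (cases "n = 0")
  case True
  then show ?thesis
    using has_integral_const_real[of "1::complex" 0 "2 * pi"] by (simp add: scaleR_conv_of_real)
next
  case False
  define F where "F = (\<lambda>t. cis (of_int n * t) / (\<i> * of_int n))"
  have "(F has_vector_derivative cis (of_int n * t)) (at t within {0..2 * pi})" for t
    unfolding F_def cis_conv_exp
    by (rule has_vector_derivative_eq_rhs, (rule derivative_eq_intros has_vector_derivative_real_field | simp)+)
       (use False in \<open>auto simp: field_simps\<close>)
  then have "((\<lambda>t. cis (of_int n * t)) has_integral (F (2 * pi) - F 0)) {0..2 * pi}"
    by (intro fundamental_theorem_of_calculus) auto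
  moreover have "F (2 * pi) = F 0"
    using cis_multiple_2pi[of "of_int n"] by (simp add: F_def mult_ac)
  ultimately show ?thesis using False by simp
qed

text \<open>
  Parseval's identity for a polynomial on the circle of radius \<open>r\<close>.
\<close>

lemma has_integral_norm_sq_circle:
  fixes p :: "nat \<Rightarrow> complex" and r :: real
  shows "((\<lambda>t. (norm (\<Sum>k\<le>K. p k * (of_real r * cis t) ^ k))\<^sup>2) has_integral
           (2 * pi * (\<Sum>k\<le>K. (norm (p k))\<^sup>2 * r ^ (2 * k)))) {0..2 * pi}"
proof -
  define c where "c = (\<lambda>j k. p j * cnj (p k) * of_real (r ^ (j + k)))"
  have eq: "of_real ((norm (\<Sum>k\<le>K. p k * (of_real r * cis t) ^ k))\<^sup>2) =
      (\<Sum>j\<le>K. \<Sum>k\<le>K. c j k * cis (of_int (int j - int k) * t))" for t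
  proof -
    have "of_real ((norm (\<Sum>k\<le>K. p k * (of_real r * cis t) ^ k))\<^sup>2) =
        (\<Sum>j\<le>K. p j * (of_real r * cis t) ^ j) * (\<Sum>k\<le>K. cnj (p k * (of_real r * cis t) ^ k))"
      by (simp add: complex_norm_square del: of_real_power)
    also have "\<dots> = (\<Sum>j\<le>K. \<Sum>k\<le>K. c j k * cis (of_int (int j - int k) * t))"
      unfolding sum_product
    proof (intro sum.cong refl)
      fix j k
      have "cis (of_int (int j - int k) * t) = cis t ^ j * cis (-t) ^ k"
        unfolding Complex.DeMoivre cis_mult by (simp add: algebra_simps)
      then show "p j * (of_real r * cis t) ^ j * cnj (p k * (of_real r * cis t) ^ k) =
          c j k * cis (of_int (int j - int k) * t)"
        by (simp add: c_def power_mult_distrib power_add cis_cnj mult_ac)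
    qed
    finally show ?thesis .
  qed
  have "((\<lambda>t. \<Sum>j\<le>K. \<Sum>k\<le>K. c j k * cis (of_int (int j - int k) * t)) has_integral
      (\<Sum>j\<le>K. \<Sum>k\<le>K. c j k * (if int j - int k = 0 then of_real (2 * pi) else 0))) {0..2 * pi}"
    by (intro has_integral_sum has_integral_mult_right has_integral_cis_int) auto
  also have "(\<Sum>j\<le>K. \<Sum>k\<le>K. c j k * (if int j - int k = 0 then of_real (2 * pi) else 0)) =
      (\<Sum>j\<le>K. c j j * of_real (2 * pi))"
    by (intro sum.cong refl) (simp add: if_distrib sum.delta cong: if_cong)
  also have "\<dots> = of_real (2 * pi * (\<Sum>k\<le>K. (norm (p k))\<^sup>2 * r ^ (2 * k)))"
  proof -
    have "c j j = of_real ((norm (p j))\<^sup>2 * r ^ (2 * j))" for j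
      unfolding c_def of_real_mult complex_norm_square by (simp add: mult_2)
    then show ?thesis
      by (simp add: sum_distrib_right sum_distrib_left mult_ac)
  qed
  finally have "((\<lambda>t. of_real ((norm (\<Sum>k\<le>K. p k * (of_real r * cis t) ^ k))\<^sup>2)) has_integral
      complex_of_real (2 * pi * (\<Sum>k\<le>K. (norm (p k))\<^sup>2 * r ^ (2 * k)))) {0..2 * pi}"
    unfolding eq .
  from has_integral_linear[OF this bounded_linear_Re] show ?thesis
    by (simp add: o_def del: of_real_power)
qed

text \<open>
  On the circle of radius \<open>r < 1\<close> the modulus of \<open>f P\<^sup>2\<close> is at most \<open>|P|\<^sup>2\<close>, so Cauchy's formula and
  Parseval's identity bound the coefficient by \<open>r ^ (-N) \<Sum> |p\<^sub>k|\<^sup>2\<close>; then \<open>r\<close> tends to \<open>1\<close>.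
  The polynomial is encoded as a formal power series with coefficients vanishing beyond \<open>K\<close>.
\<close>

lemma norm_coeff_mult_square_le:
  assumes f: "f \<in> schur_class" and P: "\<And>k. k > K \<Longrightarrow> fps_nth P k = 0"
  shows "norm (fps_nth (fps_expansion f 0 * P\<^sup>2) N) \<le> (\<Sum>k\<le>K. (norm (fps_nth P k))\<^sup>2)"
proof -
  have holf: "f holomorphic_on ball 0 1" and f1: "\<And>z. norm z < 1 \<Longrightarrow> norm (f z) \<le> 1"
    using f by (auto simp: schur_class_def analytic_on_open)
  define p where "p = fps_nth P"
  define S where "S = (\<Sum>k\<le>K. (norm (p k))\<^sup>2)"
  define Q where "Q = (\<lambda>z. \<Sum>k\<le>K. p k * z ^ k)"
  define g where "g = (\<lambda>z. f z * Q z ^ 2)"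
  define b where "b = fps_nth (fps_expansion f 0 * P\<^sup>2) N"
  have P_eq: "P = (\<Sum>k\<le>K. fps_const (p k) * fps_X ^ k)"
    using P by (intro fps_ext) (auto simp: fps_sum_nth p_def fps_mult_left_const_nth if_distrib sum.delta cong: if_cong)
  have Q: "Q has_fps_expansion P"
    unfolding Q_def P_eq by (intro fps_expansion_intros)
  have holg: "g holomorphic_on ball 0 1"
    unfolding g_def Q_def by (intro holomorphic_intros holf)
  have "f has_fps_expansion fps_expansion f 0"
    by (rule has_fps_expansion_fps_expansion[OF _ _ holf]) auto
  then have "g has_fps_expansion (fps_expansion f 0 * P\<^sup>2)"
    unfolding g_def by (intro fps_expansion_intros Q)
  then have b_deriv: "b = (deriv ^^ N) g 0 / fact N"
    unfolding b_def by (rule fps_nth_fps_expansion)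
  have bound: "r ^ N * norm b \<le> S" if r: "0 < r" "r < 1" for r :: real
  proof -
    have sub: "cball 0 r \<subseteq> ball (0::complex) 1" using r by auto
    have contg: "continuous_on (cball 0 r) g"
      using holg holomorphic_on_imp_continuous_on continuous_on_subset sub by blast
    have holg': "g holomorphic_on ball 0 r"
      using holg by (rule holomorphic_on_subset) (use r in auto)
    have z: "of_real r * cis t \<in> ball (0::complex) 1" for t using r by (simp add: norm_mult)
    have nz: "of_real r * cis t \<noteq> 0" for t using r by simp
    have "b = 1 / (2 * pi * \<i>) * contour_integral (part_circlepath 0 r 0 (2 * pi)) (\<lambda>u. g u / (u - 0) ^ Suc N)"
      unfolding b_deriv
      using Cauchy_higher_derivative_integral_circlepath(2)[OF contg holg', of 0 N] r
      by (simp add: circlepath_def)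
    also have "contour_integral (part_circlepath 0 r 0 (2 * pi)) (\<lambda>u. g u / (u - 0) ^ Suc N) =
        integral {0..2 * pi} (\<lambda>t. \<i> * (g (of_real r * cis t) / (of_real r * cis t) ^ N))"
      using nz by (subst contour_integral_part_circlepath_eq)
        (auto intro!: integral_cong simp: field_simps)
    also have "\<dots> = \<i> * integral {0..2 * pi} (\<lambda>t. g (of_real r * cis t) / (of_real r * cis t) ^ N)"
      by (rule integral_mult_right)
    finally have b_int: "2 * pi * b = integral {0..2 * pi} (\<lambda>t. g (of_real r * cis t) / (of_real r * cis t) ^ N)"
      by (simp add: field_simps)
    have sq: "((\<lambda>t. (norm (Q (of_real r * cis t)))\<^sup>2) has_integral
           (2 * pi * (\<Sum>k\<le>K. (norm (p k))\<^sup>2 * r ^ (2 * k)))) {0..2 * pi}"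
      unfolding Q_def by (rule has_integral_norm_sq_circle)
    have "norm (integral {0..2 * pi} (\<lambda>t. g (of_real r * cis t) / (of_real r * cis t) ^ N)) \<le>
        integral {0..2 * pi} (\<lambda>t. (norm (Q (of_real r * cis t)))\<^sup>2 / r ^ N)"
    proof (rule integral_norm_bound_integral)
      have "continuous_on {0..2 * pi} (\<lambda>t. g (of_real r * cis t))"
        by (rule continuous_on_compose2[OF contg]) (use r in \<open>auto intro!: continuous_intros simp: norm_mult\<close>)
      then show "(\<lambda>t. g (of_real r * cis t) / (of_real r * cis t) ^ N) integrable_on {0..2 * pi}"
        by (intro integrable_continuous_real continuous_intros) (use nz in auto)
      show "(\<lambda>t. (norm (Q (of_real r * cis t)))\<^sup>2 / r ^ N) integrable_on {0..2 * pi}"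
        using has_integral_divide[OF sq] by blast
    next
      fix t
      have "norm (f (of_real r * cis t)) \<le> 1" using f1 z by simp
      then have "norm (g (of_real r * cis t)) \<le> 1 * (norm (Q (of_real r * cis t)))\<^sup>2"
        unfolding g_def norm_mult norm_power by (intro mult_right_mono) auto
      then show "norm (g (of_real r * cis t) / (of_real r * cis t) ^ N) \<le> (norm (Q (of_real r * cis t)))\<^sup>2 / r ^ N"
        using r by (simp add: norm_divide norm_mult norm_power divide_right_mono)
    qed
    also have "\<dots> = 2 * pi * (\<Sum>k\<le>K. (norm (p k))\<^sup>2 * r ^ (2 * k)) / r ^ N"
      by (rule integral_unique[OF has_integral_divide[OF sq]])
    also have "\<dots> = 2 * pi * ((\<Sum>k\<le>K. (norm (p k))\<^sup>2 * r ^ (2 * k)) / r ^ N)"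
      by simp
    finally have "2 * pi * norm b \<le> 2 * pi * ((\<Sum>k\<le>K. (norm (p k))\<^sup>2 * r ^ (2 * k)) / r ^ N)"
      unfolding b_int[symmetric] norm_mult by simp
    then have "norm b \<le> (\<Sum>k\<le>K. (norm (p k))\<^sup>2 * r ^ (2 * k)) / r ^ N"
      by (rule mult_left_le_imp_le) simp
    also have "\<dots> \<le> S / r ^ N"
      unfolding S_def using r
      by (intro divide_right_mono sum_mono mult_left_le power_le_one) auto
    finally show ?thesis using r by (simp add: field_simps)
  qed
  have "((\<lambda>r::real. r ^ N * norm b) \<longlongrightarrow> 1 ^ N * norm b) (at_left 1)"
    by (intro tendsto_intros)
  moreover have "\<forall>\<^sub>F r in at_left (1::real). r ^ N * norm b \<le> S"
    using eventually_at_left_real[of 0 1] by (rule eventually_mono) (use bound in auto)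
  ultimately have "1 ^ N * norm b \<le> S"
    by (intro tendsto_upperbound) auto
  then show ?thesis by (simp add: b_def S_def p_def)
qed

section \<open>Carlson's coefficient inequalities\<close>

text \<open>
  The common source of both Carlson inequalities. The preceding bound is applied with \<open>N = d + n\<close> and
  \<open>P = 1 + X ^ d R\<close>, where the coefficients of \<open>R\<close> are, up to a unimodular factor \<open>u\<close>,
  the numbers \<open>w i * cnj (a i)\<close> with \<open>i = n, \<dots>, 0\<close> in this order. In
  \<open>f P\<^sup>2 = f + 2 X ^ d f R + X ^ (2d) f R\<^sup>2\<close> the last term reaches the index \<open>N\<close> only if \<open>n = d\<close>,
  because \<open>n \<le> d\<close>.
\<close>

lemma weighted_coeff_bound:
  assumes f: "f \<in> schur_class" and d: "1 \<le> d" "n \<le> d" and w: "\<And>i. w i \<ge> (0::real)"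
  defines "a \<equiv> taylor_coeff f"
  shows "norm (a (d + n)) + 2 * (\<Sum>i\<le>n. w i * (norm (a i))\<^sup>2) \<le>
    1 + (\<Sum>i\<le>n. (w i)\<^sup>2 * (norm (a i))\<^sup>2) + (if n = d then norm (a 0) * (w n * norm (a n))\<^sup>2 else 0)"
proof -
  define F where "F = fps_expansion f 0"
  \<comment> \<open>The factor \<open>u\<close> makes all leading contributions to the coefficient point in the same direction.\<close>
  obtain u where u: "a (d + n) = u * of_real (norm (a (d + n)))" "norm u = 1"
  proof (cases "a (d + n) = 0")
    case False
    then show ?thesis
      by (intro that[of "sgn (a (d + n))"]) (auto simp: norm_divide sgn_eq)
  qed (auto intro: that[of 1])
  define R where "R = Abs_fps (\<lambda>j. if j \<le> n then u * cnj (a (n - j)) * of_real (w (n - j)) else 0)"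
  define P where "P = 1 + fps_X ^ d * R"
  have P_nth: "fps_nth P k = (if k = 0 then 1 else if d \<le> k \<and> k \<le> d + n
      then u * cnj (a (n - (k - d))) * of_real (w (n - (k - d))) else 0)" for k
    using d by (auto simp: P_def R_def fps_X_power_mult_nth)
  have "F * P\<^sup>2 = F + fps_X ^ d * (2 * (F * R)) + fps_X ^ (d + d) * (F * R\<^sup>2)"
    by (simp add: P_def power2_eq_square power_add algebra_simps)
  then have coeff: "fps_nth (F * P\<^sup>2) (d + n) = a (d + n) + 2 * fps_nth (F * R) n +
      (if n = d then fps_nth F 0 * (fps_nth R 0)\<^sup>2 else 0)"
    using d by (simp add: fps_X_power_mult_nth F_def a_def numeral_fps_const power2_eq_square mult_2[symmetric])
  have FR: "fps_nth (F * R) n = u * of_real (\<Sum>i\<le>n. w i * (norm (a i))\<^sup>2)"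
  proof -
    have "fps_nth (F * R) n = (\<Sum>i\<le>n. a i * (u * cnj (a i) * of_real (w i)))"
      unfolding fps_mult_nth atMost_atLeast0 by (intro sum.cong refl) (auto simp: F_def a_def R_def)
    then show ?thesis
      by (simp add: sum_distrib_left complex_norm_square mult_ac del: of_real_power)
  qed
  define B where "B = norm (a (d + n)) + 2 * (\<Sum>i\<le>n. w i * (norm (a i))\<^sup>2)"
  have "a (d + n) + 2 * fps_nth (F * R) n = u * of_real B"
    by (subst u(1)) (simp add: FR B_def algebra_simps)
  moreover have "B \<ge> 0" unfolding B_def using w by (intro add_nonneg_nonneg sum_nonneg mult_nonneg_nonneg) auto
  ultimately have "B = norm (a (d + n) + 2 * fps_nth (F * R) n)"
    using u(2) by (simp add: norm_mult)
  also have "\<dots> = norm (fps_nth (F * P\<^sup>2) (d + n) - (if n = d then fps_nth F 0 * (fps_nth R 0)\<^sup>2 else 0))"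
    by (simp add: coeff)
  also have "\<dots> \<le> norm (fps_nth (F * P\<^sup>2) (d + n)) + (if n = d then norm (a 0) * (w n * norm (a n))\<^sup>2 else 0)"
    by (rule order_trans[OF norm_triangle_ineq4])
       (use u(2) in \<open>auto simp: F_def a_def R_def norm_mult norm_power power_mult_distrib\<close>)
  also have "norm (fps_nth (F * P\<^sup>2) (d + n)) \<le> (\<Sum>k\<le>d + n. (norm (fps_nth P k))\<^sup>2)"
    unfolding F_def by (rule norm_coeff_mult_square_le[OF f]) (auto simp: P_nth)
  also have "(\<Sum>k\<le>d + n. (norm (fps_nth P k))\<^sup>2) = 1 + (\<Sum>i\<le>n. (w i)\<^sup>2 * (norm (a i))\<^sup>2)"
  proof -
    have "(\<Sum>k\<le>d + n. (norm (fps_nth P k))\<^sup>2) = (\<Sum>k\<in>insert 0 {d..d + n}. (norm (fps_nth P k))\<^sup>2)"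
      by (intro sum.mono_neutral_right) (auto simp: P_nth)
    also have "\<dots> = 1 + (\<Sum>k\<in>{d..d + n}. (norm (fps_nth P k))\<^sup>2)"
      using d by (subst sum.insert) (auto simp: P_nth)
    also have "(\<Sum>k\<in>{d..d + n}. (norm (fps_nth P k))\<^sup>2) = (\<Sum>i\<le>n. (w i)\<^sup>2 * (norm (a i))\<^sup>2)"
      by (rule sum.reindex_bij_witness[of _ "\<lambda>i. d + (n - i)" "\<lambda>k. n - (k - d)"])
         (use d u(2) in \<open>auto simp: P_nth norm_mult power_mult_distrib\<close>)
    finally show ?thesis .
  qed
  finally show ?thesis unfolding B_def by simp
qed

lemma Carlson_odd:
  assumes f: "f \<in> schur_class"
  defines "a \<equiv> taylor_coeff f"
  shows "norm (a (2 * n + 1)) \<le> 1 - (\<Sum>i\<le>n. (norm (a i))\<^sup>2)"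
proof -
  have "norm (a (n + 1 + n)) + 2 * (\<Sum>i\<le>n. (norm (a i))\<^sup>2) \<le> 1 + (\<Sum>i\<le>n. (norm (a i))\<^sup>2)"
    using weighted_coeff_bound[OF f, of "n + 1" n "\<lambda>_. 1"] unfolding a_def[symmetric] by simp
  then have "norm (a (n + 1 + n)) \<le> 1 - (\<Sum>i\<le>n. (norm (a i))\<^sup>2)"
    by linarith
  then show ?thesis by (simp add: mult_2)
qed

lemma Carlson_even:
  assumes f: "f \<in> schur_class" and n: "n \<ge> 1"
  defines "a \<equiv> taylor_coeff f"
  shows "norm (a (2 * n)) \<le> 1 - (\<Sum>i<n. (norm (a i))\<^sup>2) - (norm (a n))\<^sup>2 / (1 + norm (a 0))"
proof -
  define c where "c = 1 + norm (a 0)"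
  have c: "c > 0" by (auto simp: c_def intro: add_pos_nonneg)
  define s where "s = (\<Sum>i<n. (norm (a i))\<^sup>2)"
  define x where "x = norm (a n)"
  \<comment> \<open>The weight \<open>1 / (1 + norm (a 0))\<close> minimises \<open>- 2 w x\<^sup>2 + (1 + norm (a 0)) w\<^sup>2 x\<^sup>2\<close>.\<close>
  define w where "w i = (if i = n then 1 / c else 1)" for i
  have 1: "(\<Sum>i\<le>n. w i * (norm (a i))\<^sup>2) = s + x\<^sup>2 / c"
    unfolding s_def by (subst lessThan_Suc_atMost[symmetric]) (simp add: w_def x_def)
  have 2: "(\<Sum>i\<le>n. (w i)\<^sup>2 * (norm (a i))\<^sup>2) = s + x\<^sup>2 / c\<^sup>2"
    unfolding s_def by (subst lessThan_Suc_atMost[symmetric]) (simp add: w_def x_def power_divide)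
  have "norm (a (n + n)) + 2 * (s + x\<^sup>2 / c) \<le> 1 + (s + x\<^sup>2 / c\<^sup>2) + (c - 1) * (1 / c * x)\<^sup>2"
    using weighted_coeff_bound[OF f, of n n w] n c
    unfolding a_def[symmetric] 1 2 by (simp only: w_def x_def c_def if_True refl) simp
  also have "\<dots> = 1 + s + x\<^sup>2 / c"
    using c by (simp add: power2_eq_square left_diff_distrib add_divide_distrib[symmetric])
  finally have "norm (a (n + n)) \<le> 1 - s - x\<^sup>2 / c"
    by argo
  moreover have "n + n = 2 * n" by simp
  ultimately show ?thesis by (simp only: s_def x_def c_def)
qed

section \<open>The bound for the tail\<close>

text \<open>
  The finite form of the tail bound: each induction step adds the Carlson inequalities with
  the indices \<open>2 * N + 2\<close> and \<open>2 * N + 3\<close>. The last summand on the right is what is still missing from the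
  weights of the squares after finitely many steps.
\<close>

lemma schur_tail_partial_sum_le:
  assumes f: "f \<in> schur_class" and r: "0 \<le> r" "r < 1"
  defines "a \<equiv> taylor_coeff f"
  shows "(\<Sum>i<2 * N + 1. norm (a (i + 1)) * r ^ (i + 1)) +
     (1 / (1 + norm (a 0)) + r / (1 - r)) * (\<Sum>k<N. (norm (a (k + 1)))\<^sup>2 * r ^ (2 * (k + 1)))
     \<le> (1 - (norm (a 0))\<^sup>2) * (r - r ^ (2 * N + 2)) / (1 - r) +
        (\<Sum>k<N. (norm (a (k + 1)))\<^sup>2) * r ^ (2 * N + 2) / (1 - r)"
proof (induction N)
  case 0
  have "norm (a 1) * r \<le> (1 - (norm (a 0))\<^sup>2) * r"
    using Carlson_odd[OF f, of 0] r by (intro mult_right_mono) (auto simp: a_def)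
  also have "(1 - (norm (a 0))\<^sup>2) * r = (1 - (norm (a 0))\<^sup>2) * (r - r ^ 2) / (1 - r)"
    using r by (simp add: field_simps power2_eq_square)
  finally show ?case by (simp add: power2_eq_square)
next
  case (Suc N)
  \<comment> \<open>Here \<open>S\<close> is the sum of squares so far, \<open>x\<close> the new square, and \<open>R\<close> the first new power of \<open>r\<close>.\<close>
  define D where "D = 1 - (norm (a 0))\<^sup>2"
  define S where "S = (\<Sum>k<N. (norm (a (k + 1)))\<^sup>2)"
  define x where "x = (norm (a (N + 1)))\<^sup>2"
  define q where "q = 1 / (1 + norm (a 0))"
  define R where "R = r ^ (2 * N + 2)"
  define L where "L = (\<Sum>i<2 * N + 1. norm (a (i + 1)) * r ^ (i + 1))"
  define M where "M = (\<Sum>k<N. (norm (a (k + 1)))\<^sup>2 * r ^ (2 * (k + 1)))"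
  have R0: "R \<ge> 0" using r by (simp add: R_def)
  have head: "(\<Sum>i<Suc N. (norm (a i))\<^sup>2) = (norm (a 0))\<^sup>2 + S"
    unfolding S_def by (subst sum.lessThan_Suc_shift) simp
  have even: "norm (a (2 * N + 2)) \<le> D - S - q * x"
    using Carlson_even[OF f, of "N + 1"] head unfolding a_def[symmetric] by (simp add: D_def q_def x_def)
  have odd: "norm (a (2 * N + 3)) \<le> D - S - x"
  proof -
    have "(\<Sum>i\<le>N + 1. (norm (a i))\<^sup>2) = (norm (a 0))\<^sup>2 + S + x"
      using head by (simp add: lessThan_Suc_atMost[symmetric] x_def)
    then show ?thesis
      using Carlson_odd[OF f, of "N + 1"] unfolding a_def[symmetric] by (simp add: D_def numeral_3_eq_3)
  qed
  define L' where "L' = (\<Sum>i<2 * Suc N + 1. norm (a (i + 1)) * r ^ (i + 1))"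
  define c where "c = q + r / (1 - r)"
  have "L' =
      L + norm (a (2 * N + 2)) * R + norm (a (2 * N + 3)) * (r * R)"
    by (simp add: L'_def L_def R_def numeral_3_eq_3)
  also have "\<dots> \<le> L + (D - S - q * x) * R + (D - S - x) * (r * R)"
    using even odd r R0 by (intro add_mono mult_right_mono) auto
  finally have "L' + c * (M + x * R) \<le>
      (L + c * M) + (D - S - q * x) * R + (D - S - x) * (r * R) + c * (x * R)"
    by (simp add: distrib_left)
  also have "\<dots> \<le> (D * (r - R) / (1 - r) + S * R / (1 - r)) +
      (D - S - q * x) * R + (D - S - x) * (r * R) + c * (x * R)"
    using Suc.IH by (simp add: L_def M_def D_def c_def q_def R_def S_def)
  also have "\<dots> = D * (r - R * r\<^sup>2) / (1 - r) + (S + x) * (R * r\<^sup>2) / (1 - r)"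
    using r by (simp add: c_def divide_simps) (simp add: algebra_simps power2_eq_square)
  finally show ?case
    by (simp add: L'_def c_def M_def x_def R_def D_def S_def q_def power2_eq_square mult_ac)
qed

lemma norm_taylor_coeff_le_1:
  assumes "f \<in> schur_class"
  shows "norm (taylor_coeff f n) \<le> 1"
proof -
  have "norm (fps_nth (fps_expansion f 0 * 1\<^sup>2) n) \<le> (\<Sum>k\<le>0. (norm (fps_nth (1 :: complex fps) k))\<^sup>2)"
    by (rule norm_coeff_mult_square_le[OF assms]) simp
  then show ?thesis by simp
qed

lemma summable_norm_taylor_coeff:
  assumes f: "f \<in> schur_class" and r: "0 \<le> r" "r < 1"
  shows "summable (\<lambda>n. norm (taylor_coeff f (n + 1)) * r ^ (n + 1))"
    and "summable (\<lambda>n. (norm (taylor_coeff f (n + 1)))\<^sup>2 * r ^ (2 * (n + 1)))"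
proof -
  show "summable (\<lambda>n. norm (taylor_coeff f (n + 1)) * r ^ (n + 1))"
  proof (rule summable_comparison_test')
    show "summable (\<lambda>n. r ^ n * r)" using r by (intro summable_mult2 summable_geometric) simp
    show "norm (norm (taylor_coeff f (n + 1)) * r ^ (n + 1)) \<le> r ^ n * r" for n
      using mult_right_mono[OF norm_taylor_coeff_le_1[OF f, of "n + 1"], of "r ^ (n + 1)"] r
      by (simp add: mult.commute)
  qed
  show "summable (\<lambda>n. (norm (taylor_coeff f (n + 1)))\<^sup>2 * r ^ (2 * (n + 1)))"
  proof (rule summable_comparison_test')
    have "r\<^sup>2 < 1" using r by (simp add: power_less_one_iff)
    then show "summable (\<lambda>n. (r\<^sup>2) ^ n * r\<^sup>2)" using r by (intro summable_mult2 summable_geometric) simp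
    show "norm ((norm (taylor_coeff f (n + 1)))\<^sup>2 * r ^ (2 * (n + 1))) \<le> (r\<^sup>2) ^ n * r\<^sup>2" for n
    proof -
      have "(norm (taylor_coeff f (n + 1)))\<^sup>2 \<le> 1"
        using norm_taylor_coeff_le_1[OF f, of "n + 1"] by (simp add: power_le_one)
      then have "(norm (taylor_coeff f (n + 1)))\<^sup>2 * r ^ (2 * (n + 1)) \<le> 1 * r ^ (2 * (n + 1))"
        using r by (intro mult_right_mono) auto
      also have "\<dots> = (r\<^sup>2) ^ n * r\<^sup>2"
        by (simp add: power_mult[symmetric] power_add[symmetric] add.commute)
      finally show ?thesis using r by simp
    qed
  qed
qed

text \<open>
  In the finite form, the sum of squares on the right is at most \<open>1 - (norm (a 0))\<^sup>2\<close>, again by Carlson's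
  inequality. This turns the right-hand side into a bound that does not depend on the number of terms.
\<close>

lemma bohr_tail_le:
  assumes f: "f \<in> schur_class" and r: "0 \<le> r" "r < 1"
  shows "bohr_tail f r \<le> (1 - (norm (taylor_coeff f 0))\<^sup>2) * (r / (1 - r))"
proof -
  define a where "a = taylor_coeff f"
  define D where "D = 1 - (norm (a 0))\<^sup>2"
  define c where "c = (1 + norm (a 0) * r) / ((1 + norm (a 0)) * (1 - r))"
  have a0: "1 + norm (a 0) > 0" by (intro add_pos_nonneg) auto
  have c: "c = 1 / (1 + norm (a 0)) + r / (1 - r)"
    using a0 r unfolding c_def by (simp add: field_simps)
  define U where "U = (\<lambda>n. \<Sum>i<n. norm (a (i + 1)) * r ^ (i + 1))"
  define V where "V = (\<lambda>n. \<Sum>k<n. (norm (a (k + 1)))\<^sup>2 * r ^ (2 * (k + 1)))"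
  have "U \<longlonglongrightarrow> bohr_sum 1 f r"
    unfolding U_def bohr_sum_def a_def by (intro summable_LIMSEQ summable_norm_taylor_coeff f r)
  moreover have "filterlim (\<lambda>n::nat. 2 * n + 1) sequentially sequentially"
    by (intro filterlim_subseq strict_monoI) auto
  ultimately have U: "(\<lambda>n. U (2 * n + 1)) \<longlonglongrightarrow> bohr_sum 1 f r"
    by (rule filterlim_compose)
  have V: "V \<longlonglongrightarrow> f0_norm_sq f r"
    unfolding V_def f0_norm_sq_def a_def by (intro summable_LIMSEQ summable_norm_taylor_coeff f r)
  have "U (2 * n + 1) + c * V n \<le> D * (r / (1 - r))" for n
  proof -
    define R where "R = r ^ (2 * n + 2)"
    define S where "S = (\<Sum>k<n. (norm (a (k + 1)))\<^sup>2)"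
    have "0 \<le> norm (a (2 * n + 1))" by simp
    also have "\<dots> \<le> 1 - (\<Sum>i\<le>n. (norm (a i))\<^sup>2)"
      unfolding a_def by (rule Carlson_odd[OF f])
    also have "(\<Sum>i\<le>n. (norm (a i))\<^sup>2) = (norm (a 0))\<^sup>2 + S"
      unfolding S_def by (subst lessThan_Suc_atMost[symmetric], subst sum.lessThan_Suc_shift) simp
    finally have "S \<le> D" by (simp add: D_def)
    then have "S * R / (1 - r) \<le> D * R / (1 - r)"
      using r by (intro divide_right_mono mult_right_mono) (auto simp: R_def)
    moreover have "U (2 * n + 1) + c * V n \<le> D * (r - R) / (1 - r) + S * R / (1 - r)"
      using schur_tail_partial_sum_le[OF f r, of n] unfolding a_def[symmetric] c U_def V_def D_def R_def S_def .
    moreover have "D * (r - R) / (1 - r) + D * R / (1 - r) = D * (r / (1 - r))"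
      by (simp add: algebra_simps add_divide_distrib[symmetric])
    ultimately show ?thesis by linarith
  qed
  then have "bohr_sum 1 f r + c * f0_norm_sq f r \<le> D * (r / (1 - r))"
    by (intro LIMSEQ_le_const2[OF tendsto_add[OF U tendsto_mult_left[OF V]]]) auto
  then show ?thesis
    by (simp add: bohr_tail_def Let_def c_def a_def D_def)
qed

section \<open>Schwarz and Schwarz-Pick lemmas\<close>

text \<open>
  The Schwarz lemma under the non-strict hypothesis \<open>|f| \<le> 1\<close>, obtained by applying the
  strict version to \<open>t f\<close> for all \<open>t < 1\<close>.
\<close>

lemma Schwarz_Lemma_nonstrict:
  assumes holf: "f holomorphic_on ball 0 1" and f0: "f 0 = 0"
    and f1: "\<And>z. norm z < 1 \<Longrightarrow> norm (f z) \<le> 1"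
  shows "norm z < 1 \<Longrightarrow> norm (f z) \<le> norm z" and "norm (deriv f 0) \<le> 1"
proof -
  have holt: "(\<lambda>z. of_real t * f z) holomorphic_on ball 0 1" for t
    by (intro holomorphic_intros holf)
  have lt: "norm (of_real t * f z) < 1" if "norm z < 1" "0 < t" "t < 1" for t :: real and z
  proof -
    have "norm (of_real t * f z) \<le> t * 1"
      unfolding norm_mult using that f1 by (intro mult_mono) auto
    with that show ?thesis by simp
  qed
  have "t * norm (f z) \<le> norm z" if "norm z < 1" "0 < t" "t < 1" for t z
  proof -
    have "norm (of_real t * f z) \<le> norm z"
      by (rule Schwarz_Lemma(1)[where f = "\<lambda>z. of_real t * f z", OF holt _ lt]) (use f0 that in auto)
    with that show ?thesis by (simp add: norm_mult)
  qed
  then show "norm (f z) \<le> norm z" if "norm z < 1"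
    using that by (blast intro: field_le_mult_one_interval)
  have "f field_differentiable at 0"
    using holf by (rule holomorphic_on_imp_differentiable_at) auto
  then have deriv_t: "deriv (\<lambda>z. of_real t * f z) 0 = of_real t * deriv f 0" for t
    by (rule deriv_cmult)
  have "t * norm (deriv f 0) \<le> 1" if "0 < t" "t < 1" for t
  proof -
    have "norm (deriv (\<lambda>z. of_real t * f z) 0) \<le> 1"
      by (rule Schwarz_Lemma(2)[where f = "\<lambda>z. of_real t * f z" and \<xi> = 0, OF holt _ lt])
         (use f0 that in auto)
    with that show ?thesis by (simp add: deriv_t norm_mult)
  qed
  then show "norm (deriv f 0) \<le> 1"
    by (blast intro: field_le_mult_one_interval)
qed

text \<open>
  By induction on the order: \<open>f z = z * h z\<close>, where \<open>h\<close> is again bounded by \<open>1\<close> and has one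
  vanishing coefficient less.
\<close>

lemma Schwarz_Lemma_order:
  assumes "f holomorphic_on ball 0 1" and "\<And>z. norm z < 1 \<Longrightarrow> norm (f z) \<le> 1"
    and "\<And>k. k < m \<Longrightarrow> taylor_coeff f k = 0" and z: "norm z < 1"
  shows "norm (f z) \<le> norm z ^ m"
  using assms(1-3)
proof (induction m arbitrary: f)
  case 0
  then show ?case using z by simp
next
  case (Suc m)
  have f0: "f 0 = 0"
    using Suc.prems(3)[of 0] by (simp add: fps_expansion_def)
  obtain h where h: "h holomorphic_on ball 0 1" "\<And>z. norm z < 1 \<Longrightarrow> f z = z * h z" "deriv f 0 = h 0"
    using Schwarz3[OF Suc.prems(1) f0] by blast
  have h1: "norm (h w) \<le> 1" if "norm w < 1" for w
  proof (cases "w = 0")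
    case True
    then show ?thesis using h(3) Schwarz_Lemma_nonstrict(2)[OF Suc.prems(1) f0 Suc.prems(2)] by simp
  next
    case False
    have "norm w * norm (h w) \<le> norm w * 1"
      using Schwarz_Lemma_nonstrict(1)[OF Suc.prems(1) f0 Suc.prems(2) that] h(2)[OF that]
      by (simp add: norm_mult)
    then show ?thesis using False by simp
  qed
  have "h has_fps_expansion fps_expansion h 0"
    by (rule has_fps_expansion_fps_expansion[OF _ _ h(1)]) auto
  then have "(\<lambda>w. w * h w) has_fps_expansion (fps_X * fps_expansion h 0)"
    by (intro fps_expansion_intros)
  moreover have "\<forall>\<^sub>F w in nhds 0. f w = w * h w"
    using eventually_nhds_in_open[of "ball 0 1" "0 :: complex"]
    by (rule eventually_mono) (use h(2) in auto)
  then have "fps_expansion f 0 = fps_expansion (\<lambda>w. w * h w) 0"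
    by (rule fps_expansion_cong)
  ultimately have "fps_expansion f 0 = fps_X * fps_expansion h 0"
    by (simp add: fps_expansion_eqI)
  then have "taylor_coeff h k = 0" if "k < m" for k
    using Suc.prems(3)[of "Suc k"] that by simp
  then have "norm (h z) \<le> norm z ^ m"
    using Suc.IH[OF h(1) h1] by blast
  then show ?case
    using h(2)[OF z] by (simp add: norm_mult mult_left_mono)
qed

lemma norm_sq_moebius_identity:
  "(norm (1 - cnj c * u))\<^sup>2 - (norm (u - c))\<^sup>2 = (1 - (norm u)\<^sup>2) * (1 - (norm c)\<^sup>2)"
  unfolding cmod_power2 by (simp add: power2_eq_square algebra_simps)

text \<open>
  The Moebius map \<open>u \<mapsto> (u - c) / (1 - cnj c * u)\<close> sends the closed unit disc into itself;
  stated without the quotient, whose denominator may vanish if \<open>|c| = 1\<close>.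
\<close>

lemma norm_diff_le_norm_one_minus:
  assumes "norm u \<le> 1" "norm c \<le> 1"
  shows "norm (u - c) \<le> norm (1 - cnj c * u)"
proof -
  have "(1 - (norm u)\<^sup>2) * (1 - (norm c)\<^sup>2) \<ge> 0"
    using assms by (intro mult_nonneg_nonneg) (auto simp: power_le_one)
  then have "(norm (u - c))\<^sup>2 \<le> (norm (1 - cnj c * u))\<^sup>2"
    using norm_sq_moebius_identity[of c u] by linarith
  then show ?thesis by (rule power2_le_imp_le) simp
qed

lemma Schwarz_Pick_growth:
  assumes holf: "f holomorphic_on ball 0 1" and f1: "\<And>z. norm z < 1 \<Longrightarrow> norm (f z) \<le> 1"
    and w: "norm w \<le> s" and s: "s < 1"
  shows "norm (f w) \<le> (norm (f 0) + s) / (1 + norm (f 0) * s)"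
proof -
  define c where "c = f 0"
  define a where "a = norm c"
  define x where "x = norm (f w)"
  have s0: "s \<ge> 0" using w norm_ge_zero order_trans by blast
  have a: "0 \<le> a" "a \<le> 1" and x: "0 \<le> x" "x \<le> 1"
    using f1[of 0] f1[of w] w s by (auto simp: a_def c_def x_def)
  have pos: "1 + a * s > 0" using a s0 by (intro add_pos_nonneg) auto
  have "x * (1 + a * s) \<le> a + s"
  \<comment> \<open>For \<open>a = 1\<close> the bound is the trivial one, and the Moebius map below could degenerate.\<close>
  proof (cases "a = 1")
    case True
    then show ?thesis using x s0 mult_right_mono[of x 1 "1 + s"] by simp
  next
    case False
    have ne: "1 - cnj c * f z \<noteq> 0" if "norm z < 1" for z
    proof
      assume "1 - cnj c * f z = 0"
      then have "1 = norm (cnj c * f z)" by simp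
      also have "\<dots> \<le> a * 1"
        unfolding norm_mult a_def using f1[OF that] by (intro mult_mono) auto
      finally show False using False a by simp
    qed
    \<comment> \<open>Composing with a Moebius map moves the value at \<open>0\<close> to \<open>0\<close>.\<close>
    define g where "g = (\<lambda>z. (f z - c) / (1 - cnj c * f z))"
    have "norm (g w) \<le> norm w"
    proof (rule Schwarz_Lemma_nonstrict(1))
      show "g holomorphic_on ball 0 1"
        unfolding g_def using ne by (intro holomorphic_intros holf) auto
      show "norm (g z) \<le> 1" if "norm z < 1" for z
        unfolding g_def norm_divide
        using norm_diff_le_norm_one_minus[OF f1[OF that], of c] a ne[OF that]
        by (simp add: a_def divide_le_eq)
    qed (use w s in \<open>auto simp: g_def c_def\<close>)
    then have "norm (f w - c) / norm (1 - cnj c * f w) \<le> s"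
      using w by (simp add: g_def norm_divide)
    then have "norm (f w - c) \<le> s * norm (1 - cnj c * f w)"
      using ne[of w] w s by (simp add: divide_le_eq)
    then have sq_le: "(norm (f w - c))\<^sup>2 \<le> (s * norm (1 - cnj c * f w))\<^sup>2"
      by (intro power_mono) auto
    define M where "M = (1 - x\<^sup>2) * (1 - a\<^sup>2)"
    define y where "y = (1 - a * x)\<^sup>2"
    define v where "v = (norm (1 - cnj c * f w))\<^sup>2"
    define t where "t = s\<^sup>2"
    have "v - (norm (f w - c))\<^sup>2 = M"
      using norm_sq_moebius_identity[of c "f w"] unfolding v_def M_def x_def a_def .
    moreover have "(norm (f w - c))\<^sup>2 \<le> t * v"
      using sq_le unfolding power_mult_distrib v_def t_def .
    ultimately have "v * (1 - t) \<le> M"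
      by (simp add: right_diff_distrib mult.commute)
    moreover have "y * (1 - t) \<le> v * (1 - t)"
      unfolding y_def v_def t_def
    proof (intro mult_right_mono power_mono)
      show "1 - a * x \<le> norm (1 - cnj c * f w)"
        using norm_triangle_ineq2[of 1 "cnj c * f w"] by (simp add: norm_mult a_def x_def)
      show "0 \<le> 1 - a * x" using a x by (simp add: mult_le_one)
      show "0 \<le> 1 - s\<^sup>2" using s s0 by (simp add: power_le_one)
    qed
    moreover have "(x - a)\<^sup>2 = y - M"
      by (simp add: y_def M_def power2_eq_square algebra_simps)
    ultimately have "(x - a)\<^sup>2 \<le> t * y"
      by (simp add: right_diff_distrib mult.commute)
    then have "(x - a)\<^sup>2 \<le> (s * (1 - a * x))\<^sup>2"
      by (simp only: power_mult_distrib t_def y_def)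
    then have "x - a \<le> s * (1 - a * x)"
      by (rule power2_le_imp_le) (use s0 a x in \<open>simp add: mult_le_one\<close>)
    then show ?thesis by (simp add: algebra_simps)
  qed
  then show ?thesis using pos by (simp add: x_def a_def c_def pos_le_divide_eq)
qed

section \<open>Validity of both inequalities\<close>

text \<open>
  The defect from \<open>1\<close> in explicit form. For \<open>0 \<le> a < 1\<close>, \<open>R \<ge> 0\<close> and \<open>r < 1\<close> its sign is the sign of
  the last factor, and the same holds in the next lemma. This decides both the validity of the
  inequalities and their sharpness.
\<close>

lemma one_minus_moebius_identity:
  fixes a R r :: real
  assumes "1 + a * R \<noteq> 0" "r \<noteq> 1"
  shows "1 - ((a + R) / (1 + a * R) + (1 - a\<^sup>2) * (r / (1 - r))) =
    (1 - a) / ((1 + a * R) * (1 - r)) * ((1 - R) * (1 - r) - (1 + a) * r * (1 + a * R))"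
proof -
  define q where "q = 1 + a * R"
  define p where "p = 1 - r"
  have "q \<noteq> 0" "p \<noteq> 0" using assms by (auto simp: q_def p_def)
  then have "1 - ((a + R) / q + (1 - a\<^sup>2) * (r / p)) = ((q - (a + R)) * p - (1 - a\<^sup>2) * r * q) / (q * p)"
    by (simp add: divide_simps) (simp add: algebra_simps)
  also have "(q - (a + R)) * p - (1 - a\<^sup>2) * r * q = (1 - a) * ((1 - R) * p - (1 + a) * r * q)"
    by (simp add: q_def p_def power2_eq_square algebra_simps)
  finally show ?thesis by (simp add: q_def p_def)
qed

lemma one_minus_moebius_sq_identity:
  fixes a R r :: real
  assumes "1 + a * R \<noteq> 0" "r \<noteq> 1"
  shows "1 - (((a + R) / (1 + a * R))\<^sup>2 + (1 - a\<^sup>2) * (r / (1 - r))) =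
    (1 - a\<^sup>2) / ((1 + a * R)\<^sup>2 * (1 - r)) * ((1 - R\<^sup>2) * (1 - r) - r * (1 + a * R)\<^sup>2)"
proof -
  define q where "q = 1 + a * R"
  define p where "p = 1 - r"
  have "q\<^sup>2 \<noteq> 0" "p \<noteq> 0" using assms by (auto simp: q_def p_def)
  then have "1 - (((a + R) / q)\<^sup>2 + (1 - a\<^sup>2) * (r / p)) = ((q\<^sup>2 - (a + R)\<^sup>2) * p - (1 - a\<^sup>2) * r * q\<^sup>2) / (q\<^sup>2 * p)"
    unfolding power_divide by (simp add: divide_simps) (simp add: algebra_simps)
  also have "(q\<^sup>2 - (a + R)\<^sup>2) * p - (1 - a\<^sup>2) * r * q\<^sup>2 = (1 - a\<^sup>2) * ((1 - R\<^sup>2) * p - r * q\<^sup>2)"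
    by (simp add: q_def p_def power2_eq_square algebra_simps)
  finally show ?thesis by (simp add: q_def p_def)
qed

lemma norm_comp_le:
  assumes f: "f \<in> schur_class" and \<omega>: "\<omega> \<in> schur_class_ord m" and m: "m \<ge> 1" and z: "norm z < 1"
  shows "norm (f (\<omega> z)) \<le> (norm (f 0) + norm z ^ m) / (1 + norm (f 0) * norm z ^ m)"
proof (rule Schwarz_Pick_growth)
  show "f holomorphic_on ball 0 1" and "\<And>z. norm z < 1 \<Longrightarrow> norm (f z) \<le> 1"
    using f by (auto simp: schur_class_def analytic_on_open)
  show "norm (\<omega> z) \<le> norm z ^ m"
    by (rule Schwarz_Lemma_order)
       (use \<omega> z in \<open>auto simp: schur_class_ord_def schur_class_def analytic_on_open fps_expansion_def\<close>)
  have "norm z ^ m \<le> norm z ^ 1"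
    using m z by (intro power_decreasing) auto
  then show "norm z ^ m < 1" using z by simp
qed

lemma bohr_tail_le_at_0:
  assumes "f \<in> schur_class" "0 \<le> r" "r < 1"
  shows "bohr_tail f r \<le> (1 - (norm (f 0))\<^sup>2) * (r / (1 - r))"
  using bohr_tail_le[OF assms] by (simp add: fps_expansion_def)

text \<open>
  The hypothesis is the condition for \<open>a = 1\<close>, which is the most restrictive one since
  \<open>(1 + a) r (1 + a R)\<close> increases with \<open>a\<close>.
\<close>

lemma A_fun_le_1:
  assumes f: "f \<in> schur_class" and \<omega>: "\<omega> \<in> schur_class_ord m" and m: "m \<ge> 1" and z: "norm z < 1"
    and cond: "2 * norm z * (1 + norm z ^ m) \<le> (1 - norm z) * (1 - norm z ^ m)"
  shows "A_fun f \<omega> z \<le> 1"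
proof -
  define a where "a = norm (f 0)"
  define r where "r = norm z"
  define R where "R = r ^ m"
  have r: "0 \<le> r" "r < 1" using z by (auto simp: r_def)
  have R: "0 \<le> R" using r by (simp add: R_def)
  have a: "0 \<le> a" "a \<le> 1" using f by (auto simp: a_def schur_class_def)
  have pos: "1 + a * R > 0" using a R by (intro add_pos_nonneg) auto
  have "(1 + a) * r * (1 + a * R) \<le> 2 * r * (1 + R)"
    using a r R mult_right_mono[of a 1 R] by (intro mult_mono mult_right_mono) auto
  also have "\<dots> \<le> (1 - R) * (1 - r)"
    using cond by (simp only: r_def R_def mult.commute)
  finally have "0 \<le> (1 - a) / ((1 + a * R) * (1 - r)) * ((1 - R) * (1 - r) - (1 + a) * r * (1 + a * R))"
    using a r pos by (intro mult_nonneg_nonneg divide_nonneg_pos mult_pos_pos) auto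
  then have "(a + R) / (1 + a * R) + (1 - a\<^sup>2) * (r / (1 - r)) \<le> 1"
    using one_minus_moebius_identity[of a R r] pos r by linarith
  moreover have "A_fun f \<omega> z \<le> (a + R) / (1 + a * R) + (1 - a\<^sup>2) * (r / (1 - r))"
    unfolding A_fun_def using norm_comp_le[OF f \<omega> m z] bohr_tail_le_at_0[OF f r]
    by (simp only: a_def r_def R_def add_mono)
  ultimately show ?thesis by linarith
qed

lemma B_fun_le_1:
  assumes f: "f \<in> schur_class" and \<omega>: "\<omega> \<in> schur_class_ord m" and m: "m \<ge> 1" and z: "norm z < 1"
    and cond: "2 * norm z + norm z ^ m \<le> 1"
  shows "B_fun f \<omega> z \<le> 1"
proof -
  define a where "a = norm (f 0)"
  define r where "r = norm z"
  define R where "R = r ^ m"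
  have r: "0 \<le> r" "r < 1" using z by (auto simp: r_def)
  have R: "0 \<le> R" using r by (simp add: R_def)
  have a: "0 \<le> a" "a \<le> 1" using f by (auto simp: a_def schur_class_def)
  have pos: "1 + a * R > 0" using a R by (intro add_pos_nonneg) auto
  have "r * (1 + a * R)\<^sup>2 \<le> r * (1 + R)\<^sup>2"
    using a r R mult_right_mono[of a 1 R] by (intro mult_left_mono power_mono) auto
  also have "\<dots> = (1 - R\<^sup>2) * (1 - r) - (1 + R) * (1 - 2 * r - R)"
    by (simp add: power2_eq_square algebra_simps)
  also have "\<dots> \<le> (1 - R\<^sup>2) * (1 - r)"
    using cond R by (simp add: r_def R_def)
  finally have "0 \<le> (1 - a\<^sup>2) / ((1 + a * R)\<^sup>2 * (1 - r)) * ((1 - R\<^sup>2) * (1 - r) - r * (1 + a * R)\<^sup>2)"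
    using a r pos by (intro mult_nonneg_nonneg divide_nonneg_pos mult_pos_pos) (auto simp: power_le_one)
  then have "((a + R) / (1 + a * R))\<^sup>2 + (1 - a\<^sup>2) * (r / (1 - r)) \<le> 1"
    using one_minus_moebius_sq_identity[of a R r] pos r by linarith
  moreover have "(norm (f (\<omega> z)))\<^sup>2 \<le> ((a + R) / (1 + a * R))\<^sup>2"
    using norm_comp_le[OF f \<omega> m z] by (intro power_mono) (simp_all add: a_def r_def R_def)
  moreover have "bohr_tail f r \<le> (1 - a\<^sup>2) * (r / (1 - r))"
    unfolding a_def by (rule bohr_tail_le_at_0[OF f r])
  ultimately show ?thesis by (simp add: B_fun_def r_def[symmetric])
qed

section \<open>Extremal functions\<close>

text \<open>
  The automorphism of the unit disc that maps \<open>0\<close> to \<open>a\<close> (for real \<open>a\<close> between \<open>-1\<close> and \<open>1\<close>).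
  These are the extremal functions.
\<close>

definition disc_aut :: "real \<Rightarrow> complex \<Rightarrow> complex" where
  "disc_aut a z = (z + of_real a) / (1 + of_real a * z)"

lemma disc_aut_in_schur_class:
  assumes "0 < a" "a < 1"
  shows "disc_aut a \<in> schur_class"
proof -
  have ne: "1 + of_real a * z \<noteq> 0" if "norm z < 1" for z :: complex
  proof
    assume "1 + of_real a * z = 0"
    then have "norm (of_real a * z) = norm (- 1 :: complex)"
      by (metis add_eq_0_iff)
    moreover have "a * norm z < 1 * 1"
      using assms that by (intro mult_strict_mono) auto
    ultimately show False using assms by (simp add: norm_mult)
  qed
  have "norm (disc_aut a z) \<le> 1" if "norm z < 1" for z
    using norm_diff_le_norm_one_minus[of z "- of_real a"] assms that ne[OF that]
    by (simp add: disc_aut_def norm_divide divide_le_eq)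
  moreover have "disc_aut a holomorphic_on ball 0 1"
    unfolding disc_aut_def using ne by (intro holomorphic_intros) auto
  ultimately show ?thesis
    by (auto simp: schur_class_def analytic_on_open)
qed

lemma taylor_coeff_disc_aut:
  "taylor_coeff (disc_aut a) 0 = of_real a"
  "taylor_coeff (disc_aut a) (n + 1) = of_real (1 - a\<^sup>2) * (- of_real a) ^ n"
proof -
  define c where "c = complex_of_real a"
  define F where "F = Abs_fps (\<lambda>n. if n = 0 then c else (1 - c\<^sup>2) * (- c) ^ (n - 1))"
  have F: "F * (1 + fps_const c * fps_X) = fps_X + fps_const c"
  proof (rule fps_ext)
    fix n
    have shift: "F * (1 + fps_const c * fps_X) = F + fps_const c * (F * fps_X)"
      by (simp only: distrib_left mult_1_right mult.left_commute)
    consider "n = 0" | "n = 1" | k where "n = Suc (Suc k)" by (metis One_nat_def not0_implies_Suc)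
    then show "fps_nth (F * (1 + fps_const c * fps_X)) n = fps_nth (fps_X + fps_const c) n"
      unfolding shift by cases (auto simp: F_def fps_mult_left_const_nth power2_eq_square)
  qed
  have "disc_aut a has_fps_expansion (fps_X + fps_const c) / (1 + fps_const c * fps_X)"
    unfolding disc_aut_def c_def[symmetric] by (intro fps_expansion_intros) simp
  also have "(fps_X + fps_const c) / (1 + fps_const c * fps_X) = F"
    unfolding F[symmetric] by (rule nonzero_mult_div_cancel_right) (auto simp: fps_eq_iff intro!: exI[of _ 0])
  finally have "fps_expansion (disc_aut a) 0 = F" by (rule fps_expansion_eqI)
  then show "taylor_coeff (disc_aut a) 0 = of_real a"
    "taylor_coeff (disc_aut a) (n + 1) = of_real (1 - a\<^sup>2) * (- of_real a) ^ n"
    by (simp_all add: F_def c_def)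
qed

lemma power_in_schur_class_ord: "(\<lambda>z. z ^ m) \<in> schur_class_ord m"
proof -
  have "(deriv ^^ k) (\<lambda>z. z ^ m) 0 = (fact k * fps_nth (fps_X ^ m) k :: complex)" for k
    using fps_nth_fps_expansion[OF has_fps_expansion_fps_X_power[of m], of k] by simp
  moreover have "(\<lambda>z::complex. z ^ m) \<in> schur_class"
    by (auto simp: schur_class_def norm_power power_le_one intro!: analytic_intros)
  ultimately show ?thesis
    by (auto simp: schur_class_ord_def)
qed

text \<open>
  Equality in the tail bound.
\<close>

lemma bohr_tail_disc_aut:
  assumes a: "0 < a" "a < 1" and r: "0 \<le> r" "r < 1"
  shows "bohr_tail (disc_aut a) r = (1 - a\<^sup>2) * (r / (1 - r))"
proof -
  define D where "D = 1 - a\<^sup>2"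
  have D: "D > 0" using a by (simp add: D_def power_less_one_iff)
  have nrm: "norm (taylor_coeff (disc_aut a) (n + 1)) = D * a ^ n" for n
    unfolding taylor_coeff_disc_aut norm_mult norm_power norm_of_real norm_minus_cancel D_def[symmetric] using a D by simp
  have "a * r < 1 * 1" using a r by (intro mult_strict_mono) auto
  then have ar: "0 \<le> a * r" "a * r < 1" using a r by auto
  have "(\<lambda>n. D * r * (a * r) ^ n) sums (D * r * (1 / (1 - a * r)))"
    using ar by (intro sums_mult geometric_sums) simp
  then have B: "bohr_sum 1 (disc_aut a) r = D * r / (1 - a * r)"
    unfolding bohr_sum_def nrm by (simp add: sums_iff power_mult_distrib mult_ac)
  have term_eq: "(D * a ^ n)\<^sup>2 * r ^ (2 * (n + 1)) = (D * r)\<^sup>2 * ((a * r)\<^sup>2) ^ n" for n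
  proof -
    have "(D * a ^ n)\<^sup>2 * r ^ (2 * (n + 1)) = (D * a ^ n * r ^ (n + 1))\<^sup>2"
      unfolding power_even_eq by (simp only: power_mult_distrib)
    also have "D * a ^ n * r ^ (n + 1) = (D * r) * (a * r) ^ n"
      by (simp add: power_mult_distrib mult_ac)
    also have "\<dots>\<^sup>2 = (D * r)\<^sup>2 * ((a * r)\<^sup>2) ^ n"
      by (simp only: power_mult_distrib[of "D * r"] power_mult[symmetric] mult.commute)
    finally show ?thesis .
  qed
  have "(\<lambda>n. (D * r)\<^sup>2 * ((a * r)\<^sup>2) ^ n) sums ((D * r)\<^sup>2 * (1 / (1 - (a * r)\<^sup>2)))"
    using ar by (intro sums_mult geometric_sums) (simp add: power_less_one_iff)
  then have N: "f0_norm_sq (disc_aut a) r = (D * r)\<^sup>2 / (1 - (a * r)\<^sup>2)"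
    unfolding f0_norm_sq_def nrm term_eq by (simp add: sums_iff)
  define p where "p = 1 - a * r"
  have D_fac: "D = (1 + a) * (1 - a)" by (simp add: D_def power2_eq_square algebra_simps)
  have "(1 + a * r) / ((1 + a) * (1 - r)) * ((D * r)\<^sup>2 / (1 - (a * r)\<^sup>2)) = D * (1 - a) * r\<^sup>2 / ((1 - r) * p)"
  proof -
    have "1 - (a * r)\<^sup>2 = (1 + a * r) * p" by (simp add: p_def power2_eq_square algebra_simps)
    moreover have "1 + a * r \<noteq> 0" using ar by linarith
    ultimately show ?thesis
      using a r by (simp add: D_fac power2_eq_square)
  qed
  then have "bohr_tail (disc_aut a) r = D * r / p + D * (1 - a) * r\<^sup>2 / ((1 - r) * p)"
    unfolding bohr_tail_def Let_def B N taylor_coeff_disc_aut using a by (simp add: p_def)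
  also have "\<dots> = D * r * ((1 - r) + (1 - a) * r) / ((1 - r) * p)"
  proof -
    have "D * r / p = D * r * (1 - r) / ((1 - r) * p)" using r by simp
    then show ?thesis
      by (simp only: add_divide_distrib[symmetric]) (simp add: power2_eq_square distrib_left mult_ac)
  qed
  also have "(1 - r) + (1 - a) * r = p" by (simp add: p_def algebra_simps)
  finally show ?thesis using ar by (simp add: D_def p_def)
qed

lemma norm_disc_aut_of_real:
  assumes "0 < a" "0 \<le> R"
  shows "norm (disc_aut a (of_real R)) = (a + R) / (1 + a * R)"
proof -
  have "disc_aut a (of_real R) = of_real ((a + R) / (1 + a * R))"
    by (simp add: disc_aut_def add.commute)
  moreover have "(a + R) / (1 + a * R) \<ge> 0"
    using assms by (intro divide_nonneg_nonneg add_nonneg_nonneg mult_nonneg_nonneg) auto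
  ultimately show ?thesis by (simp only: norm_of_real abs_of_nonneg)
qed

text \<open>
  If the inequality holds at the point \<open>\<rho>\<close> for all admissible functions, then testing it on
  \<open>disc_aut a\<close> and \<open>z ^ m\<close> and letting \<open>a\<close> tend to \<open>1\<close> bounds \<open>\<rho>\<close>.
\<close>

lemma A_fun_le_1_imp_cond:
  assumes \<rho>: "0 < \<rho>" "\<rho> < 1"
    and le: "\<And>f \<omega>. f \<in> schur_class \<Longrightarrow> \<omega> \<in> schur_class_ord m \<Longrightarrow> A_fun f \<omega> (of_real \<rho>) \<le> 1"
  shows "2 * \<rho> * (1 + \<rho> ^ m) \<le> (1 - \<rho>) * (1 - \<rho> ^ m)"
proof -
  define R where "R = \<rho> ^ m"
  have R: "0 \<le> R" using \<rho> by (simp add: R_def)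
  have "(1 + a) * \<rho> * (1 + a * R) \<le> (1 - R) * (1 - \<rho>)" if a: "a \<in> {0<..<1}" for a
  proof -
    have pos: "1 + a * R > 0" using a R by (intro add_pos_nonneg) auto
    have "A_fun (disc_aut a) (\<lambda>z. z ^ m) (of_real \<rho>) = (a + R) / (1 + a * R) + (1 - a\<^sup>2) * (\<rho> / (1 - \<rho>))"
      using a \<rho> R norm_disc_aut_of_real[of a R] bohr_tail_disc_aut[of a \<rho>] by (simp add: A_fun_def R_def)
    then have "0 \<le> (1 - a) / ((1 + a * R) * (1 - \<rho>)) * ((1 - R) * (1 - \<rho>) - (1 + a) * \<rho> * (1 + a * R))"
      using le[OF disc_aut_in_schur_class power_in_schur_class_ord, of a] a
        one_minus_moebius_identity[of a R \<rho>] pos \<rho> by simp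
    moreover have "(1 - a) / ((1 + a * R) * (1 - \<rho>)) > 0"
      using a pos \<rho> by (intro divide_pos_pos mult_pos_pos) auto
    ultimately show ?thesis by (simp only: zero_le_mult_iff) linarith
  qed
  then have "\<forall>\<^sub>F a in at_left 1. (1 + a) * \<rho> * (1 + a * R) \<le> (1 - R) * (1 - \<rho>)"
    by (intro eventually_mono[OF eventually_at_left_real[of 0 1]]) auto
  moreover have "((\<lambda>a. (1 + a) * \<rho> * (1 + a * R)) \<longlongrightarrow> (1 + 1) * \<rho> * (1 + 1 * R)) (at_left 1)"
    by (intro tendsto_intros)
  ultimately have "(1 + 1) * \<rho> * (1 + 1 * R) \<le> (1 - R) * (1 - \<rho>)"
    by (intro tendsto_upperbound[of _ _ "at_left (1::real)"]) auto
  then show ?thesis by (simp add: R_def mult.commute)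
qed

lemma B_fun_le_1_imp_cond:
  assumes \<rho>: "0 < \<rho>" "\<rho> < 1"
    and le: "\<And>f \<omega>. f \<in> schur_class \<Longrightarrow> \<omega> \<in> schur_class_ord m \<Longrightarrow> B_fun f \<omega> (of_real \<rho>) \<le> 1"
  shows "2 * \<rho> + \<rho> ^ m \<le> 1"
proof -
  define R where "R = \<rho> ^ m"
  have R: "0 \<le> R" using \<rho> by (simp add: R_def)
  have "\<rho> * (1 + a * R)\<^sup>2 \<le> (1 - R\<^sup>2) * (1 - \<rho>)" if a: "a \<in> {0<..<1}" for a
  proof -
    have pos: "1 + a * R > 0" using a R by (intro add_pos_nonneg) auto
    have "B_fun (disc_aut a) (\<lambda>z. z ^ m) (of_real \<rho>) = ((a + R) / (1 + a * R))\<^sup>2 + (1 - a\<^sup>2) * (\<rho> / (1 - \<rho>))"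
      using a \<rho> R norm_disc_aut_of_real[of a R] bohr_tail_disc_aut[of a \<rho>] by (simp add: B_fun_def R_def)
    then have "0 \<le> (1 - a\<^sup>2) / ((1 + a * R)\<^sup>2 * (1 - \<rho>)) * ((1 - R\<^sup>2) * (1 - \<rho>) - \<rho> * (1 + a * R)\<^sup>2)"
      using le[OF disc_aut_in_schur_class power_in_schur_class_ord, of a] a
        one_minus_moebius_sq_identity[of a R \<rho>] pos \<rho> by simp
    moreover have "(1 - a\<^sup>2) / ((1 + a * R)\<^sup>2 * (1 - \<rho>)) > 0"
      using a pos \<rho> by (intro divide_pos_pos mult_pos_pos) (auto simp: power_less_one_iff)
    ultimately show ?thesis by (simp only: zero_le_mult_iff) linarith
  qed
  then have "\<forall>\<^sub>F a in at_left 1. \<rho> * (1 + a * R)\<^sup>2 \<le> (1 - R\<^sup>2) * (1 - \<rho>)"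
    by (intro eventually_mono[OF eventually_at_left_real[of 0 1]]) auto
  moreover have "((\<lambda>a. \<rho> * (1 + a * R)\<^sup>2) \<longlongrightarrow> \<rho> * (1 + 1 * R)\<^sup>2) (at_left 1)"
    by (intro tendsto_intros)
  ultimately have "\<rho> * (1 + 1 * R)\<^sup>2 \<le> (1 - R\<^sup>2) * (1 - \<rho>)"
    by (intro tendsto_upperbound[of _ _ "at_left (1::real)"]) auto
  \<comment> \<open>The difference of the two sides has the factor \<open>1 + R\<close>.\<close>
  then have "0 \<le> (1 + R) * (1 - 2 * \<rho> - R)"
    by (simp add: power2_eq_square algebra_simps)
  then show ?thesis using R by (simp add: zero_le_mult_iff R_def)
qed

section \<open>The defining equations of the two constants\<close>

lemma ex1_root_strict_antimono:
  fixes h :: "real \<Rightarrow> real"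
  assumes cont: "continuous_on {0..1} h" and h: "h 0 > 0" "h 1 < 0"
    and anti: "\<And>r s. 0 \<le> r \<Longrightarrow> r < s \<Longrightarrow> s \<le> 1 \<Longrightarrow> h s < h r"
  shows "\<exists>!r. r \<in> {0<..<1} \<and> h r = 0"
proof -
  obtain r where r: "0 \<le> r" "r \<le> 1" "h r = 0"
    using IVT2'[of h 1 0 0] cont h by auto
  have "r \<noteq> 0" "r \<noteq> 1" using r h by auto
  moreover have "s = r" if "s \<in> {0<..<1}" "h s = 0" for s
    using anti[of r s] anti[of s r] r that by (cases s r rule: linorder_cases) auto
  ultimately show ?thesis using r by (intro ex1I[of _ r]) auto
qed

lemma alpha_poly_strict_antimono:
  fixes r s :: real
  assumes "0 \<le> r" "r < s" "s \<le> 1"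
  shows "(1 - s) * (1 - s ^ m) - 2 * s * (1 + s ^ m) < (1 - r) * (1 - r ^ m) - 2 * r * (1 + r ^ m)"
proof -
  have pw: "r ^ m \<le> s ^ m" using assms by (intro power_mono) auto
  have "(1 - s) * (1 - s ^ m) \<le> (1 - r) * (1 - r ^ m)"
    using assms pw by (intro mult_mono) (auto simp: power_le_one)
  moreover have "2 * r * (1 + r ^ m) < 2 * s * (1 + s ^ m)"
  proof -
    have "2 * r * (1 + r ^ m) \<le> 2 * r * (1 + s ^ m)"
      using assms pw by (intro mult_left_mono) auto
    also have "\<dots> < 2 * s * (1 + s ^ m)"
      using assms by (intro mult_strict_right_mono add_pos_nonneg) auto
    finally show ?thesis .
  qed
  ultimately show ?thesis by linarith
qed

lemma beta_poly_strict_antimono: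
  fixes r s :: real
  assumes "0 \<le> r" "r < s"
  shows "1 - 2 * s - s ^ m < 1 - 2 * r - r ^ m"
proof -
  have "r ^ m \<le> s ^ m" using assms by (intro power_mono) auto
  then show ?thesis using assms by linarith
qed

section \<open>The sharp inequalities\<close>

theorem theorem1:
  fixes m :: nat
  assumes "m \<ge> 1"
  shows "(\<exists>!\<alpha>. is_alpha m \<alpha>) \<and>
    (\<forall>\<alpha>. is_alpha m \<alpha> \<longrightarrow>
       (\<forall>f\<in>schur_class. \<forall>\<omega>\<in>schur_class_ord m. \<forall>z. norm z \<le> \<alpha> \<longrightarrow> A_fun f \<omega> z \<le> 1) \<and>
       \<not> (\<exists>\<rho>\<in>{\<alpha><..<1}. \<forall>f\<in>schur_class. \<forall>\<omega>\<in>schur_class_ord m.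
             \<forall>z. norm z \<le> \<rho> \<longrightarrow> A_fun f \<omega> z \<le> 1)) \<and>
    (\<exists>!\<beta>. is_beta m \<beta>) \<and>
    (\<forall>\<beta>. is_beta m \<beta> \<longrightarrow>
       (\<forall>f\<in>schur_class. \<forall>\<omega>\<in>schur_class_ord m. \<forall>z. norm z \<le> \<beta> \<longrightarrow> B_fun f \<omega> z \<le> 1) \<and>
       \<not> (\<exists>\<rho>\<in>{\<beta><..<1}. \<forall>f\<in>schur_class. \<forall>\<omega>\<in>schur_class_ord m.
             \<forall>z. norm z \<le> \<rho> \<longrightarrow> B_fun f \<omega> z \<le> 1))"
proof (intro conjI allI impI)
  show "\<exists>!\<alpha>. is_alpha m \<alpha>"
    unfolding is_alpha_def using assms
    by (intro ex1_root_strict_antimono alpha_poly_strict_antimono continuous_intros) (auto simp: power_0_left)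
  show "\<exists>!\<beta>. is_beta m \<beta>"
    unfolding is_beta_def using assms
    by (intro ex1_root_strict_antimono beta_poly_strict_antimono continuous_intros) (auto simp: power_0_left)
next
  fix \<alpha> assume \<alpha>: "is_alpha m \<alpha>"
  show "\<forall>f\<in>schur_class. \<forall>\<omega>\<in>schur_class_ord m. \<forall>z. norm z \<le> \<alpha> \<longrightarrow> A_fun f \<omega> z \<le> 1"
  proof (intro ballI allI impI)
    fix f \<omega> and z :: complex
    assume f: "f \<in> schur_class" and \<omega>: "\<omega> \<in> schur_class_ord m" and z: "norm z \<le> \<alpha>"
    have "0 \<le> (1 - norm z) * (1 - norm z ^ m) - 2 * norm z * (1 + norm z ^ m)"
      using \<alpha> z alpha_poly_strict_antimono[of "norm z" \<alpha> m] unfolding is_alpha_def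
      by (cases "norm z = \<alpha>") auto
    then show "A_fun f \<omega> z \<le> 1"
      using \<alpha> z by (intro A_fun_le_1[OF f \<omega> assms]) (auto simp: is_alpha_def)
  qed
  show "\<not> (\<exists>\<rho>\<in>{\<alpha><..<1}. \<forall>f\<in>schur_class. \<forall>\<omega>\<in>schur_class_ord m.
             \<forall>z. norm z \<le> \<rho> \<longrightarrow> A_fun f \<omega> z \<le> 1)"
  proof
    assume "\<exists>\<rho>\<in>{\<alpha><..<1}. \<forall>f\<in>schur_class. \<forall>\<omega>\<in>schur_class_ord m.
             \<forall>z. norm z \<le> \<rho> \<longrightarrow> A_fun f \<omega> z \<le> 1"
    then obtain \<rho> where \<rho>: "\<alpha> < \<rho>" "\<rho> < 1"
      and le: "\<And>f \<omega> z. f \<in> schur_class \<Longrightarrow> \<omega> \<in> schur_class_ord m \<Longrightarrow> norm z \<le> \<rho> \<Longrightarrow> A_fun f \<omega> z \<le> 1"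
      by auto
    have \<alpha>0: "0 < \<alpha>" using \<alpha> by (simp add: is_alpha_def)
    have "2 * \<rho> * (1 + \<rho> ^ m) \<le> (1 - \<rho>) * (1 - \<rho> ^ m)"
      by (rule A_fun_le_1_imp_cond) (use \<rho> \<alpha>0 le in auto)
    then show False
      using alpha_poly_strict_antimono[of \<alpha> \<rho> m] \<alpha> \<rho> by (simp add: is_alpha_def)
  qed
next
  fix \<beta> assume \<beta>: "is_beta m \<beta>"
  show "\<forall>f\<in>schur_class. \<forall>\<omega>\<in>schur_class_ord m. \<forall>z. norm z \<le> \<beta> \<longrightarrow> B_fun f \<omega> z \<le> 1"
  proof (intro ballI allI impI)
    fix f \<omega> and z :: complex
    assume f: "f \<in> schur_class" and \<omega>: "\<omega> \<in> schur_class_ord m" and z: "norm z \<le> \<beta>"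
    have "0 \<le> 1 - 2 * norm z - norm z ^ m"
      using \<beta> z beta_poly_strict_antimono[of "norm z" \<beta> m] unfolding is_beta_def
      by (cases "norm z = \<beta>") auto
    then show "B_fun f \<omega> z \<le> 1"
      using \<beta> z by (intro B_fun_le_1[OF f \<omega> assms]) (auto simp: is_beta_def)
  qed
  show "\<not> (\<exists>\<rho>\<in>{\<beta><..<1}. \<forall>f\<in>schur_class. \<forall>\<omega>\<in>schur_class_ord m.
             \<forall>z. norm z \<le> \<rho> \<longrightarrow> B_fun f \<omega> z \<le> 1)"
  proof
    assume "\<exists>\<rho>\<in>{\<beta><..<1}. \<forall>f\<in>schur_class. \<forall>\<omega>\<in>schur_class_ord m.
             \<forall>z. norm z \<le> \<rho> \<longrightarrow> B_fun f \<omega> z \<le> 1"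
    then obtain \<rho> where \<rho>: "\<beta> < \<rho>" "\<rho> < 1"
      and le: "\<And>f \<omega> z. f \<in> schur_class \<Longrightarrow> \<omega> \<in> schur_class_ord m \<Longrightarrow> norm z \<le> \<rho> \<Longrightarrow> B_fun f \<omega> z \<le> 1"
      by auto
    have \<beta>0: "0 < \<beta>" using \<beta> by (simp add: is_beta_def)
    have "2 * \<rho> + \<rho> ^ m \<le> 1"
      by (rule B_fun_le_1_imp_cond) (use \<rho> \<beta>0 le in auto)
    then show False
      using beta_poly_strict_antimono[of \<beta> \<rho> m] \<beta> \<rho> by (simp add: is_beta_def)
  qed
qed

end
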